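(* Let $f$ be a primitive $k$-regular sequence with the data described in the context. Then the weak limit $\boldsymbol{\mu}=\big(\ast_{n=1}^{\infty}{\bf A}_n(\delta_{1/(k^n(k-1))})\big)\boldsymbol{\mu}_0=\lim_{n\to\infty}\boldsymbol{\mu}_n$ exists; that is, for each $i\in\{1,\ldots,d\}$ the measures $\mu_{n,i}$ converge weakly as $n\to\infty$ to a measure on $\mathbb{T}$.
   Context: Let $k\geqslant 2$ be an integer. For an integer sequence $f$ its $k$-kernel is $\ker_k(f)=\{(f(k^\ell n+r))_{n\geqslant 0}:\ell\geqslant 0,\ 0\leqslant r<k^\ell\}$; $f$ is $k$-regular if the $\mathbb{Q}$-span $\mathcal{V}_k(f)$ of $\ker_k(f)$ is finite-dimensional. Fix a basis $\{f=f_1,\ldots,f_d\}\subseteq\ker_k(f)$ of $\mathcal{V}_k(f)$ of integer sequences, put ${\bf f}(m)=(f_1(m),\ldots,f_d(m))^T$, and let ${\bf B}_a$ ($0\leqslant a\leqslant k-1$) be the $d\times d$ integer matrices with ${\bf f}(km+a)={\bf B}_a{\bf f}(m)$ for all $m\geqslant 0$; ${\bf B}=\sum_a{\bf B}_a$. $f$ is primitive if $f$ takes non-negative integer values, is not eventually zero, each ${\bf B}_a$ is entrywise non-negative and ${\bf B}$ is entrywise positive. Let $\mathbb{T}=[0,1)$ with addition mod $1$. For $n\geqslant 0$ let $\varSigma_i(n)=\sum_{m=k^n}^{k^{n+1}-1}f_i(m)$, $\mu_{n,i}=\frac{1}{\varSigma_i(n)}\sum_{m=0}^{k^{n+1}-k^n-1}f_i(k^n+m)\,\delta_{m/(k^n(k-1))}$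 ($\delta_x$ the unit Dirac measure at $x$), and $\boldsymbol{\mu}_n=(\mu_{n,1},\ldots,\mu_{n,d})^T$. Let ${\bf B}(z)=\sum_a{\bf B}_az^a=(b_{ij}(z))$, ${\bf A}_n(z)=\big(\varSigma_j(n-1)b_{ij}(z)/\varSigma_i(n)\big)_{i,j}$ for $n\geqslant 1$; polynomials are evaluated at Dirac measures via $p(\delta_x)=\sum_rc_r\delta_{rx}$ for $p(z)=\sum_rc_rz^r$, with convolution as multiplication, so that $\boldsymbol{\mu}_n={\bf A}_n(\delta_{1/(k^n(k-1))})\cdots{\bf A}_1(\delta_{1/(k(k-1))})\boldsymbol{\mu}_0$. *)

theory Defs
  imports
    "HOL-Probability.Probability"
    "HOL-Library.Function_Algebras"
    "HOL-Computational_Algebra.Polynomial"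
begin

section \<open>The torus\<close>

typedef torus = "{0..<1::real}"
  by (rule exI[of _ 0]) simp

setup_lifting type_definition_torus

lift_definition to_torus :: "real \<Rightarrow> torus" is frac
  by (simp add: frac_lt_1)

instantiation torus :: ab_group_add
begin

lift_definition zero_torus :: torus is 0 by simp
lift_definition plus_torus :: "torus \<Rightarrow> torus \<Rightarrow> torus" is "\<lambda>x y. frac (x + y)"
  by (simp add: frac_lt_1)
lift_definition uminus_torus :: "torus \<Rightarrow> torus" is "\<lambda>x. frac (- x)"
  by (simp add: frac_lt_1)
lift_definition minus_torus :: "torus \<Rightarrow> torus \<Rightarrow> torus" is "\<lambda>x y. frac (x - y)"
  by (simp add: frac_lt_1)

instance
proof
  fix a b c :: torus
  show "a + b + c = a + (b + c)"
    by transfer (simp add: add.assoc)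
  show "a + b = b + a"
    by transfer (simp add: add.commute)
  show "0 + a = a"
    by transfer (simp add: frac_eq)
  show "- a + a = 0"
    by transfer simp
  show "a - b = a + - b"
    by transfer simp
qed

end

lemma to_torus_add: "to_torus (x + y) = to_torus x + to_torus y"
  by transfer simp

text \<open>The topology is that of \<open>\<real>/\<int>\<close>, i.e. the quotient topology along \<^const>\<open>to_torus\<close>,
  and not the one that \<open>{0..<1}\<close> inherits from \<open>\<real>\<close>: points near 1 are close to 0.\<close>

instantiation torus :: topological_space
begin

definition open_torus :: "torus set \<Rightarrow> bool" where
  "open_torus U \<longleftrightarrow> open (to_torus -` U)"

instance
proof
  show "open (UNIV :: torus set)"
    by (simp add: open_torus_def)
  show "open (S \<inter> T)" if "open S" "open T" for S T :: "torus set"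
    using that by (auto simp: open_torus_def)
  show "open (\<Union> K)" if "\<forall>S\<in>K. open S" for K :: "torus set set"
    using that by (auto simp: open_torus_def vimage_Union)
qed

end

lemma continuous_to_torus: "continuous_on UNIV to_torus"
  by (simp add: continuous_on_open_vimage open_torus_def)


section \<open>Measures on the torus\<close>

definition measure_sum :: "('i \<Rightarrow> torus measure) \<Rightarrow> 'i set \<Rightarrow> torus measure" where
  "measure_sum M I = measure_of UNIV (sets borel) (\<lambda>X. \<Sum>i\<in>I. emeasure (M i) X)"

lemma sets_measure_sum [simp]: "sets (measure_sum M I) = sets borel"
  by (metis measure_sum_def sets.sigma_sets_eq sets_measure_of space_borel subset_UNIV Pow_UNIV)

lemma emeasure_measure_sum:
  assumes "\<And>i. i \<in> I \<Longrightarrow> sets (M i) = sets borel" and "X \<in> sets borel"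
  shows "emeasure (measure_sum M I) X = (\<Sum>i\<in>I. emeasure (M i) X)"
  unfolding measure_sum_def
proof (rule emeasure_measure_of_sigma)
  show "sigma_algebra UNIV (sets (borel :: torus measure))"
    by (metis sets.sigma_algebra_axioms space_borel)
  show "positive (sets borel) (\<lambda>X. \<Sum>i\<in>I. emeasure (M i) X)"
    by (simp add: positive_def)
  show "countably_additive (sets borel) (\<lambda>X. \<Sum>i\<in>I. emeasure (M i) X)"
  proof (rule countably_additiveI)
    fix A :: "nat \<Rightarrow> torus set"
    assume A: "range A \<subseteq> sets borel" "disjoint_family A"
    have "(\<Sum>n. \<Sum>i\<in>I. emeasure (M i) (A n)) = (\<Sum>i\<in>I. \<Sum>n. emeasure (M i) (A n))"
      by (rule suminf_sum) simp
    also have "\<dots> = (\<Sum>i\<in>I. emeasure (M i) (\<Union>n. A n))"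
      using A assms(1) by (intro sum.cong refl suminf_emeasure) auto
    finally show "(\<Sum>n. \<Sum>i\<in>I. emeasure (M i) (A n)) = (\<Sum>i\<in>I. emeasure (M i) (\<Union>n. A n))" .
  qed
qed (fact assms(2))

definition dirac :: "torus \<Rightarrow> torus measure" where
  "dirac x = return borel x"

text \<open>The library's \<open>convolution\<close> is confined to ordered Euclidean spaces.\<close>

definition torus_conv :: "torus measure \<Rightarrow> torus measure \<Rightarrow> torus measure" where
  "torus_conv M N = distr (M \<Otimes>\<^sub>M N) borel (\<lambda>(x, y). x + y)"

text \<open>The torus is compact, so the continuous test functions are automatically bounded.\<close>

definition weak_limit_torus :: "(nat \<Rightarrow> torus measure) \<Rightarrow> torus measure \<Rightarrow> bool" where
  "weak_limit_torus M N \<longleftrightarrow>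
     (\<forall>g :: torus \<Rightarrow> real. continuous_on UNIV g \<longrightarrow>
        (\<lambda>n. \<integral>x. g x \<partial>M n) \<longlonglongrightarrow> (\<integral>x. g x \<partial>N))"

text \<open>The value \<open>p(\<delta>\<^sub>x) = (\<Sum>r. c\<^sub>r \<delta>\<^bsub>rx\<^esub>)\<close>, with \<open>rx\<close> the \<open>r\<close>-fold sum of \<open>x\<close> in the torus.
  As measures take values in \<^typ>\<open>ennreal\<close>, this is meant for polynomials with non-negative
  coefficients only.\<close>

definition poly_dirac :: "real poly \<Rightarrow> torus \<Rightarrow> torus measure" where
  "poly_dirac p x =
     measure_sum (\<lambda>r. scale_measure (ennreal (coeff p r)) (dirac (\<Sum>_<r. x))) {..degree p}"

text \<open>Matrices of measures multiply with convolution as the product of entries.\<close>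

definition mconv_mm ::
    "torus measure ^ 'd ^ 'd \<Rightarrow> torus measure ^ 'd ^ 'd \<Rightarrow> torus measure ^ 'd ^ 'd" where
  "mconv_mm P Q = (\<chi> i j. measure_sum (\<lambda>l. torus_conv (P $ i $ l) (Q $ l $ j)) UNIV)"

definition mconv_mv ::
    "torus measure ^ 'd ^ 'd \<Rightarrow> torus measure ^ 'd \<Rightarrow> torus measure ^ 'd" where
  "mconv_mv P v = (\<chi> i. measure_sum (\<lambda>j. torus_conv (P $ i $ j) (v $ j)) UNIV)"

definition mconv_one :: "torus measure ^ 'd ^ 'd" where
  "mconv_one = (\<chi> i j. if i = j then dirac 0 else null_measure borel)"

text \<open>The product \<open>P\<^sub>N \<cdots> P\<^sub>1\<close>, with new factors on the left.\<close>

primrec mconv_prod :: "(nat \<Rightarrow> torus measure ^ 'd ^ 'd) \<Rightarrow> nat \<Rightarrow> torus measure ^ 'd ^ 'd" where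
  "mconv_prod P 0 = mconv_one"
| "mconv_prod P (Suc N) = mconv_mm (P (Suc N)) (mconv_prod P N)"


section \<open>Regular sequences\<close>

global_interpretation rat_seq: vector_space "\<lambda>(c :: rat) (g :: nat \<Rightarrow> rat) n. c * g n"
  defines rat_seq_span = rat_seq.span
    and rat_seq_dependent = rat_seq.dependent
  by unfold_locales (auto simp: fun_eq_iff algebra_simps)

definition rat_of_seq :: "(nat \<Rightarrow> int) \<Rightarrow> nat \<Rightarrow> rat" where
  "rat_of_seq f = (\<lambda>n. of_int (f n))"

definition k_kernel :: "nat \<Rightarrow> (nat \<Rightarrow> int) \<Rightarrow> (nat \<Rightarrow> int) set" where
  "k_kernel k f = {(\<lambda>n. f (k ^ l * n + r)) | l r. r < k ^ l}"

definition kernel_space :: "nat \<Rightarrow> (nat \<Rightarrow> int) \<Rightarrow> (nat \<Rightarrow> rat) set" where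
  "kernel_space k f = rat_seq.span (rat_of_seq ` k_kernel k f)"

definition k_regular :: "nat \<Rightarrow> (nat \<Rightarrow> int) \<Rightarrow> bool" where
  "k_regular k f \<longleftrightarrow> (\<exists>S. finite S \<and> kernel_space k f = rat_seq.span S)"

text \<open>The basis \<open>f\<^sub>1, \<dots>, f\<^sub>d\<close> is a family \<open>F\<close> indexed by a finite type, whose index
  \<open>i1\<close> plays the role of 1; a basis is indexed without repetition.\<close>

definition kernel_basis ::
    "nat \<Rightarrow> (nat \<Rightarrow> int) \<Rightarrow> ('d::finite \<Rightarrow> nat \<Rightarrow> int) \<Rightarrow> 'd \<Rightarrow> bool" where
  "kernel_basis k f F i1 \<longleftrightarrow>
     F i1 = f \<and> range F \<subseteq> k_kernel k f \<and> inj F \<and>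
     \<not> rat_seq.dependent (rat_of_seq ` range F) \<and>
     rat_seq.span (rat_of_seq ` range F) = kernel_space k f"

definition seq_vec :: "('d::finite \<Rightarrow> nat \<Rightarrow> int) \<Rightarrow> nat \<Rightarrow> int ^ 'd" where
  "seq_vec F m = (\<chi> i. F i m)"

definition digit_matrices ::
    "nat \<Rightarrow> ('d::finite \<Rightarrow> nat \<Rightarrow> int) \<Rightarrow> (nat \<Rightarrow> int ^ 'd ^ 'd) \<Rightarrow> bool" where
  "digit_matrices k F B \<longleftrightarrow> (\<forall>a<k. \<forall>m. seq_vec F (k * m + a) = B a *v seq_vec F m)"

definition primitive :: "nat \<Rightarrow> (nat \<Rightarrow> int) \<Rightarrow> (nat \<Rightarrow> int ^ 'd::finite ^ 'd) \<Rightarrow> bool" where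
  "primitive k f B \<longleftrightarrow>
     (\<forall>n. f n \<ge> 0) \<and>
     \<not> (\<forall>\<^sub>F n in sequentially. f n = 0) \<and>
     (\<forall>a<k. \<forall>i j. B a $ i $ j \<ge> 0) \<and>
     (\<forall>i j. (\<Sum>a<k. B a) $ i $ j > 0)"


section \<open>The measures attached to a regular sequence\<close>

definition Sig :: "nat \<Rightarrow> ('d \<Rightarrow> nat \<Rightarrow> int) \<Rightarrow> 'd \<Rightarrow> nat \<Rightarrow> int" where
  "Sig k F i n = (\<Sum>m = k ^ n..k ^ (n + 1) - 1. F i m)"

text \<open>For primitive \<open>f\<close> one has \<open>\<Sigma>\<^sub>i(n) > 0\<close> for all \<open>n \<ge> 1\<close>, but \<open>\<Sigma>\<^sub>i(0) = 0\<close> is possible. In that case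
  all \<open>f\<^sub>i(m)\<close> with \<open>1 \<le> m < k\<close> vanish, and \<open>\<mu>\<^bsub>0,i\<^esub>\<close> is the zero measure.\<close>

definition mu :: "nat \<Rightarrow> ('d::finite \<Rightarrow> nat \<Rightarrow> int) \<Rightarrow> nat \<Rightarrow> torus measure ^ 'd" where
  "mu k F n = (\<chi> i. measure_sum
     (\<lambda>m. scale_measure (ennreal (of_int (F i (k ^ n + m)) / of_int (Sig k F i n)))
        (dirac (to_torus (real m / (real k ^ n * (real k - 1))))))
     {0..k ^ (n + 1) - k ^ n - 1})"

definition B_poly :: "nat \<Rightarrow> (nat \<Rightarrow> int ^ 'd ^ 'd) \<Rightarrow> int poly ^ 'd ^ 'd" where
  "B_poly k B = (\<chi> i j. \<Sum>a<k. monom (B a $ i $ j) a)"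

definition A_poly ::
    "nat \<Rightarrow> ('d::finite \<Rightarrow> nat \<Rightarrow> int) \<Rightarrow> (nat \<Rightarrow> int ^ 'd ^ 'd) \<Rightarrow> nat \<Rightarrow> real poly ^ 'd ^ 'd" where
  "A_poly k F B n = (\<chi> i j.
     smult (of_int (Sig k F j (n - 1)) / of_int (Sig k F i n))
       (map_poly of_int (B_poly k B $ i $ j)))"

definition A_dirac ::
    "nat \<Rightarrow> ('d::finite \<Rightarrow> nat \<Rightarrow> int) \<Rightarrow> (nat \<Rightarrow> int ^ 'd ^ 'd) \<Rightarrow> nat \<Rightarrow> torus measure ^ 'd ^ 'd" where
  "A_dirac k F B n =
     (\<chi> i j. poly_dirac (A_poly k F B n $ i $ j) (to_torus (1 / (real k ^ n * (real k - 1)))))"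

end

theory Submission
  imports Defs
begin

text \<open>Write \<open>\<mu>\<^sub>n\<close> as the image of point masses on \<open>[0,1]\<close>. For a Lipschitz function \<open>g\<close>, refining
  each point at level \<open>n\<close> into its \<open>k\<close> children moves it by at most \<open>k\<^bsup>-(n+1)\<^esup>\<close>, so the vector of
  integrals \<open>\<integral>g d\<mu>\<^bsub>n+1,i\<^esub>\<close> is, up to a summable error, obtained from that of \<open>\<mu>\<^sub>n\<close> by applying the
  row-stochastic matrix \<open>A\<^bsub>n+1\<^esub>(1)\<close>. The entries of these matrices are bounded below by a positive
  constant since \<open>B\<close> is positive, so each step contracts the spread of the vector by a fixed
  factor, the spreads are summable, and the integrals converge. Taking \<open>g\<close> to be \<open>cos(tx)\<close> and
  \<open>sin(tx)\<close>, the characteristic functions on \<open>\<real>\<close> converge; tightness and Levy's theorem give a weak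
  limit on \<open>\<real>\<close>, whose image on the torus is the required measure.\<close>

section \<open>Measurability on the torus\<close>

lemma to_torus_Rep_torus [simp]: "to_torus (Rep_torus x) = x"
  using Rep_torus[of x] by (simp add: to_torus_def frac_eq map_fun_def Rep_torus_inverse)

lemma Rep_torus_to_torus: "Rep_torus (to_torus x) = frac x"
  by (rule to_torus.rep_eq)

text \<open>The arc avoids 0, where \<open>Rep_torus\<close> jumps. Its preimage in the line is the
  union of the integer translates of the interval from 0 to \<open>a\<close>, and \<open>a\<close>
  at most 1 makes the translate containing a point unique.\<close>

lemma open_torus_Rep_interval:
  assumes "a \<le> 1"
  shows "open {x :: torus. 0 < Rep_torus x \<and> Rep_torus x < a}"
proof -
  have "to_torus -` {x. 0 < Rep_torus x \<and> Rep_torus x < a}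
      = (\<Union>n::int. {of_int n<..<of_int n + a})" (is "?L = ?R")
  proof (intro set_eqI iffI)
    fix x assume "x \<in> ?L"
    then have "x \<in> {of_int \<lfloor>x\<rfloor><..<of_int \<lfloor>x\<rfloor> + a}"
      by (auto simp: Rep_torus_to_torus frac_def)
    then show "x \<in> ?R" by blast
  next
    fix x assume "x \<in> ?R"
    then obtain n :: int where n: "of_int n < x" "x < of_int n + a" by auto
    then have "\<lfloor>x\<rfloor> = n" using assms by linarith
    then show "x \<in> ?L" using n by (auto simp: Rep_torus_to_torus frac_def)
  qed
  then show ?thesis by (auto simp: open_torus_def)
qed

text \<open>Continuity cannot be used, since \<open>Rep_torus\<close> is discontinuous at 0; instead
  each sublevel set is built from open arcs and the single point 0.\<close>

lemma borel_measurable_Rep_torus [measurable]: "Rep_torus \<in> borel_measurable borel"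
proof (rule borel_measurableI_less)
  fix a :: real
  let ?I = "\<lambda>a. {x :: torus. 0 < Rep_torus x \<and> Rep_torus x < a}"
  have bounds: "0 \<le> Rep_torus x" "Rep_torus x < 1" for x
    using Rep_torus[of x] by auto
  have "{x. Rep_torus x < a} \<in> sets borel"
  proof -
    consider "a \<le> 0" | "0 < a" "a \<le> 1" | "1 < a" by linarith
    then show ?thesis
    proof cases
      case 1
      then have "{x. Rep_torus x < a} = {}" using bounds(1) by (auto simp: not_less intro: order_trans)
      then show ?thesis by simp
    next
      case 2
      \<comment> \<open>\<open>UNIV - ?I 1\<close> is the point 0, written as the complement of an
        open set.\<close>
      then have "{x. Rep_torus x < a} = ?I a \<union> (UNIV - ?I 1)"
        using bounds by (auto simp: not_less less_le)
      moreover have "?I a \<in> sets borel" "?I 1 \<in> sets borel"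
        using open_torus_Rep_interval 2 by (auto intro!: borel_open)
      ultimately show ?thesis by auto
    next
      case 3
      then have "{x. Rep_torus x < a} = UNIV" using bounds(2) by (auto intro: less_trans)
      then show ?thesis by simp
    qed
  qed
  then show "{x \<in> space borel. Rep_torus x < a} \<in> sets borel" by simp
qed

lemma borel_measurable_to_torus [measurable]: "to_torus \<in> borel_measurable borel"
  by (rule borel_measurable_continuous_onI) (rule continuous_to_torus)

text \<open>The torus is not an instance of a class that makes the library's measurability of addition
  available, so we go through \<open>\<real>\<close>.\<close>

lemma borel_measurable_torus_add [measurable (raw)]:
  fixes f g :: "'a \<Rightarrow> torus"
  assumes [measurable]: "f \<in> borel_measurable M" "g \<in> borel_measurable M"
  shows "(\<lambda>x. f x + g x) \<in> borel_measurable M"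
proof -
  have "(\<lambda>x. f x + g x) = (\<lambda>x. to_torus (Rep_torus (f x) + Rep_torus (g x)))"
    by (simp add: to_torus_add)
  then show ?thesis by simp
qed

section \<open>Convolution of finite measures\<close>

text \<open>The type \<open>torus measure\<close> allows any sigma-algebra and infinite mass. This
  predicate selects the finite Borel measures, to which Tonelli's theorem applies.\<close>

definition torus_finite :: "torus measure \<Rightarrow> bool" where
  "torus_finite M \<longleftrightarrow> sets M = sets borel \<and> finite_measure M"

lemma torus_finiteD:
  assumes "torus_finite M"
  shows "sets M = sets borel" "space M = UNIV" "finite_measure M" "sigma_finite_measure M"
  using assms sets_eq_imp_space_eq[of M borel]
  by (auto simp: torus_finite_def finite_measure.axioms(1))

lemma space_measure_sum [simp]: "space (measure_sum M I) = UNIV"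
  using sets_eq_imp_space_eq[OF sets_measure_sum[of M I]] by simp

lemma torus_finite_measure_sum:
  assumes "\<And>i. i \<in> I \<Longrightarrow> torus_finite (M i)" "finite I"
  shows "torus_finite (measure_sum M I)"
  unfolding torus_finite_def
proof (intro conjI finite_measureI)
  have "emeasure (measure_sum M I) UNIV = (\<Sum>i\<in>I. emeasure (M i) UNIV)"
    using assms by (intro emeasure_measure_sum) (auto dest: torus_finiteD)
  also have "\<dots> < \<infinity>"
    using assms by (auto simp: ennreal_sum_less_top less_top[symmetric] dest!: torus_finiteD(3) finite_measure.emeasure_finite)
  finally show "emeasure (measure_sum M I) (space (measure_sum M I)) \<noteq> \<infinity>"
    by simp
qed simp

text \<open>\<open>measure_sum\<close> is known through its values on Borel sets, so the formula is
  lifted by induction on measurable functions; in the limit step a finite sum of increasing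
  sequences commutes with the supremum.\<close>

lemma nn_integral_measure_sum:
  assumes "finite I" and s: "\<And>i. i \<in> I \<Longrightarrow> sets (M i) = sets borel"
    and f: "f \<in> borel_measurable borel"
  shows "(\<integral>\<^sup>+x. f x \<partial>measure_sum M I) = (\<Sum>i\<in>I. \<integral>\<^sup>+x. f x \<partial>M i)"
  using f
proof induction
  case (cong f g)
  then show ?case by simp
next
  case (set A)
  then show ?case using s by (simp add: emeasure_measure_sum)
next
  case (mult u c)
  have "u \<in> borel_measurable (M i)" if "i \<in> I" for i
    using mult s[OF that] by (simp cong: measurable_cong_sets)
  then show ?case using mult
    by (simp add: nn_integral_cmult sum_distrib_left cong: measurable_cong_sets)
next
  case (add u v)
  have "u \<in> borel_measurable (M i)" "v \<in> borel_measurable (M i)" if "i \<in> I" for i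
    using add s[OF that] by (simp_all cong: measurable_cong_sets)
  then show ?case using add
    by (simp add: nn_integral_add sum.distrib cong: measurable_cong_sets)
next
  case (seq U)
  have m: "U n \<in> borel_measurable (M i)" if "i \<in> I" for n i
    using seq s[OF that] by (simp cong: measurable_cong_sets)
  have inc: "incseq (\<lambda>n. integral\<^sup>N (M i) (U n))" for i
    using seq(3) by (auto simp: incseq_def le_fun_def intro!: nn_integral_mono)
  have "(\<integral>\<^sup>+x. Sup (range U) x \<partial>measure_sum M I) = (SUP n. \<integral>\<^sup>+x. U n x \<partial>measure_sum M I)"
    using seq by (simp add: nn_integral_monotone_convergence_SUP image_comp cong: measurable_cong_sets)
  also have "\<dots> = (\<Sum>i\<in>I. SUP n. integral\<^sup>N (M i) (U n))"
    using seq inc by (simp add: ennreal_SUP_sum)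
  also have "\<dots> = (\<Sum>i\<in>I. \<integral>\<^sup>+x. Sup (range U) x \<partial>M i)"
    using seq m by (simp add: nn_integral_monotone_convergence_SUP image_comp)
  finally show ?case .
qed

text \<open>Tonelli's theorem. It turns identities between convolutions into identities between
  iterated integrals.\<close>

lemma nn_integral_torus_conv:
  assumes M: "torus_finite M" and N: "torus_finite N" and [measurable]: "f \<in> borel_measurable borel"
  shows "(\<integral>\<^sup>+z. f z \<partial>torus_conv M N) = (\<integral>\<^sup>+x. \<integral>\<^sup>+y. f (x + y) \<partial>N \<partial>M)"
proof -
  note [measurable_cong] = torus_finiteD(1)[OF M] torus_finiteD(1)[OF N]
  interpret N: sigma_finite_measure N using torus_finiteD[OF N] by simp
  show ?thesis unfolding torus_conv_def
    by (subst nn_integral_distr) (auto simp: N.nn_integral_fst[symmetric])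
qed

lemma torus_finite_torus_conv:
  assumes M: "torus_finite M" and N: "torus_finite N"
  shows "torus_finite (torus_conv M N)"
proof -
  note [measurable_cong] = torus_finiteD(1)[OF M] torus_finiteD(1)[OF N]
  interpret M: finite_measure M using torus_finiteD[OF M] by simp
  interpret N: finite_measure N using torus_finiteD[OF N] by simp
  interpret P: finite_measure "M \<Otimes>\<^sub>M N"
    by (rule finite_measure_pair_measure) unfold_locales
  show ?thesis unfolding torus_finite_def torus_conv_def
    by (auto intro!: P.finite_measure_distr)
qed

lemma torus_measure_eqI:
  assumes "sets M = sets borel" "sets N = sets borel"
    and "\<And>X. X \<in> sets borel \<Longrightarrow> (\<integral>\<^sup>+x. indicator X x \<partial>M) = (\<integral>\<^sup>+x. indicator X x \<partial>N)"
  shows "M = (N :: torus measure)"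
  using assms by (intro measure_eqI) auto

lemma sets_torus_conv [simp]: "sets (torus_conv M N) = sets borel"
  by (simp add: torus_conv_def)

section \<open>Matrices and vectors of measures under convolution\<close>

lemma sets_mconv_mv [simp]: "sets (mconv_mv P v $ i) = sets borel"
  by (simp add: mconv_mv_def)

lemma torus_finite_mconv_mm:
  assumes "\<And>i j. torus_finite (P $ i $ j)" "\<And>i j. torus_finite (Q $ i $ j)"
  shows "torus_finite (mconv_mm P Q $ i $ j)"
  using assms by (simp add: mconv_mm_def torus_finite_measure_sum torus_finite_torus_conv)

lemma torus_finite_mconv_mv:
  assumes "\<And>i j. torus_finite (P $ i $ j)" "\<And>i. torus_finite (v $ i)"
  shows "torus_finite (mconv_mv P v $ i)"
  using assms by (simp add: mconv_mv_def torus_finite_measure_sum torus_finite_torus_conv)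

lemma nn_integral_mconv_mm:
  assumes P: "\<And>i j. torus_finite (P $ i $ j)" and Q: "\<And>i j. torus_finite (Q $ i $ j)"
    and f: "f \<in> borel_measurable borel"
  shows "(\<integral>\<^sup>+z. f z \<partial>(mconv_mm P Q $ i $ j))
    = (\<Sum>l\<in>UNIV. \<integral>\<^sup>+x. \<integral>\<^sup>+y. f (x + y) \<partial>(Q $ l $ j) \<partial>(P $ i $ l))"
  by (simp add: mconv_mm_def nn_integral_measure_sum nn_integral_torus_conv P Q f)

lemma nn_integral_mconv_mv:
  assumes P: "\<And>i j. torus_finite (P $ i $ j)" and v: "\<And>i. torus_finite (v $ i)"
    and f: "f \<in> borel_measurable borel"
  shows "(\<integral>\<^sup>+z. f z \<partial>(mconv_mv P v $ i))
    = (\<Sum>j\<in>UNIV. \<integral>\<^sup>+x. \<integral>\<^sup>+y. f (x + y) \<partial>(v $ j) \<partial>(P $ i $ j))"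
  by (simp add: mconv_mv_def nn_integral_measure_sum nn_integral_torus_conv P v f)

text \<open>Both sides integrate an indicator to the same sum of triple integrals, by associativity
  of addition on the torus and an exchange of the two index sums.\<close>

lemma mconv_mv_assoc:
  assumes P: "\<And>i j. torus_finite (P $ i $ j)" and Q: "\<And>i j. torus_finite (Q $ i $ j)"
    and v: "\<And>i. torus_finite (v $ i)"
  shows "mconv_mv (mconv_mm P Q) v = mconv_mv P (mconv_mv Q v)"
proof (rule vec_eq_iff[THEN iffD2, rule_format], rule torus_measure_eqI)
  fix i and X :: "torus set" assume [measurable]: "X \<in> sets borel"
  note PQ = torus_finite_mconv_mm[OF P Q] and Qv = torus_finite_mconv_mv[OF Q v]
  note [measurable_cong] = torus_finiteD(1)[OF P] torus_finiteD(1)[OF Q] torus_finiteD(1)[OF v]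
  \<comment> \<open>Inner integrals depend measurably on the parameter because the entries are
    sigma-finite.\<close>
  have [measurable]: "(\<lambda>x. \<integral>\<^sup>+y. f x y \<partial>(v $ j)) \<in> borel_measurable N"
    if "case_prod f \<in> borel_measurable (N \<Otimes>\<^sub>M (v $ j))" for f j and N :: "'b measure"
    using that sigma_finite_measure.borel_measurable_nn_integral[OF torus_finiteD(4)[OF v]] by blast
  have [measurable]: "(\<lambda>x. \<integral>\<^sup>+y. f x y \<partial>(Q $ l $ j)) \<in> borel_measurable N"
    if "case_prod f \<in> borel_measurable (N \<Otimes>\<^sub>M (Q $ l $ j))" for f l j and N :: "'b measure"
    using that sigma_finite_measure.borel_measurable_nn_integral[OF torus_finiteD(4)[OF Q]] by blast
  have "(\<integral>\<^sup>+z. indicator X z \<partial>(mconv_mv (mconv_mm P Q) v $ i))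
    = (\<Sum>j\<in>UNIV. \<Sum>l\<in>UNIV. \<integral>\<^sup>+x. \<integral>\<^sup>+y. \<integral>\<^sup>+z. indicator X (x + y + z) \<partial>(v $ j) \<partial>(Q $ l $ j) \<partial>(P $ i $ l))"
    by (subst nn_integral_mconv_mv[OF PQ v]) (simp_all add: nn_integral_mconv_mm[OF P Q])
  also have "\<dots> = (\<Sum>l\<in>UNIV. \<integral>\<^sup>+x. (\<Sum>j\<in>UNIV. \<integral>\<^sup>+y. \<integral>\<^sup>+z. indicator X (x + (y + z)) \<partial>(v $ j) \<partial>(Q $ l $ j)) \<partial>(P $ i $ l))"
    by (subst sum.swap) (simp add: nn_integral_sum add.assoc)
  also have "\<dots> = (\<integral>\<^sup>+z. indicator X z \<partial>(mconv_mv P (mconv_mv Q v) $ i))"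
    by (subst nn_integral_mconv_mv[OF P Qv]) (simp_all add: nn_integral_mconv_mv[OF Q v])
  finally show "(\<integral>\<^sup>+z. indicator X z \<partial>(mconv_mv (mconv_mm P Q) v $ i))
    = (\<integral>\<^sup>+z. indicator X z \<partial>(mconv_mv P (mconv_mv Q v) $ i))" .
qed simp_all

lemma sets_dirac [simp]: "sets (dirac x) = sets borel"
  by (simp add: dirac_def)

lemma torus_finite_dirac: "torus_finite (dirac x)"
  by (auto simp: torus_finite_def dirac_def intro!: prob_space.finite_measure prob_space_return)

lemma nn_integral_dirac:
  "f \<in> borel_measurable borel \<Longrightarrow> (\<integral>\<^sup>+y. f y \<partial>dirac x) = f x"
  by (simp add: dirac_def nn_integral_return)

lemma torus_finite_mconv_one: "torus_finite (mconv_one $ i $ j)"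
  by (simp add: mconv_one_def torus_finite_dirac)
     (auto simp: torus_finite_def intro!: finite_measureI)

lemma mconv_mv_one:
  assumes v: "\<And>i. torus_finite (v $ i)"
  shows "mconv_mv mconv_one v = v"
proof (rule vec_eq_iff[THEN iffD2, rule_format], rule torus_measure_eqI)
  fix i and X :: "torus set" assume [measurable]: "X \<in> sets borel"
  note [measurable_cong] = torus_finiteD(1)[OF v]
  have m: "(\<lambda>x. \<integral>\<^sup>+y. indicator X (x + y) \<partial>(v $ j)) \<in> borel_measurable borel" for j
    by (rule sigma_finite_measure.borel_measurable_nn_integral[OF torus_finiteD(4)[OF v]]) simp
  have "(\<integral>\<^sup>+x. \<integral>\<^sup>+y. indicator X (x + y) \<partial>(v $ j) \<partial>(mconv_one $ i $ j))
    = (if j = i then emeasure (v $ i) X else 0)" for j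
    using m[of j] by (auto simp: mconv_one_def nn_integral_dirac)
  then show "(\<integral>\<^sup>+z. indicator X z \<partial>(mconv_mv mconv_one v $ i)) = (\<integral>\<^sup>+z. indicator X z \<partial>(v $ i))"
    by (subst nn_integral_mconv_mv[OF torus_finite_mconv_one v]) simp_all
qed (use v in \<open>auto dest: torus_finiteD\<close>)

lemma mconv_prod_mv_Suc:
  assumes P: "\<And>n i j. torus_finite (P n $ i $ j)" and v: "\<And>i. torus_finite (v $ i)"
  shows "mconv_mv (mconv_prod P (Suc N)) v = mconv_mv (P (Suc N)) (mconv_mv (mconv_prod P N) v)"
proof -
  have "torus_finite (mconv_prod P N $ i $ j)" for i j
    by (induction N arbitrary: i j) (simp_all add: torus_finite_mconv_one torus_finite_mconv_mm P)
  then show ?thesis by (simp add: mconv_mv_assoc P v)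
qed

text \<open>The common shape of the entries of \<open>mu\<close> and of \<open>poly_dirac\<close>.
  As \<open>ennreal\<close> sends negative numbers to 0, it represents the intended sum only for
  non-negative weights.\<close>

definition point_masses :: "('i \<Rightarrow> real) \<Rightarrow> ('i \<Rightarrow> torus) \<Rightarrow> 'i set \<Rightarrow> torus measure" where
  "point_masses p h I = measure_sum (\<lambda>m. scale_measure (ennreal (p m)) (dirac (h m))) I"

lemma sets_point_masses [simp]: "sets (point_masses p h I) = sets borel"
  by (simp add: point_masses_def)

lemma torus_finite_point_masses: "finite I \<Longrightarrow> torus_finite (point_masses p h I)"
  unfolding point_masses_def
  by (rule torus_finite_measure_sum)
     (auto simp: torus_finite_def space_scale_measure dirac_def emeasure_return ennreal_mult_eq_top_iff intro!: finite_measureI)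

lemma nn_integral_point_masses:
  assumes "finite I" "f \<in> borel_measurable borel"
  shows "(\<integral>\<^sup>+x. f x \<partial>point_masses p h I) = (\<Sum>m\<in>I. ennreal (p m) * f (h m))"
  using assms unfolding point_masses_def
  by (simp add: nn_integral_measure_sum nn_integral_scale_measure nn_integral_dirac cong: measurable_cong_sets)

text \<open>Lifts point masses on the torus to the real line, where characteristic functions are
  available.\<close>

lemma point_masses_eq_distr:
  assumes "finite I" and [measurable]: "g \<in> borel_measurable borel"
  shows "point_masses p (\<lambda>m. g (x m)) I
    = distr (distr (point_measure I (\<lambda>m. ennreal (p m))) borel x) borel g"
proof (rule torus_measure_eqI)
  fix X :: "torus set" assume [measurable]: "X \<in> sets borel"
  show "(\<integral>\<^sup>+z. indicator X z \<partial>point_masses p (\<lambda>m. g (x m)) I)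
    = (\<integral>\<^sup>+z. indicator X z \<partial>distr (distr (point_measure I (\<lambda>m. ennreal (p m))) borel x) borel g)"
    by (simp add: nn_integral_point_masses assms nn_integral_distr nn_integral_point_measure_finite
        del: nn_integral_indicator)
qed simp_all

section \<open>Perturbed averaging\<close>

text \<open>At least the weight \<open>\<epsilon>\<close> falls on an index where
  \<open>\<psi>\<close> is maximal, and likewise where it is minimal. All averages therefore lie in
  an interval of length \<open>(1 - 2 * \<epsilon>) * (Max - Min)\<close>.\<close>

lemma convex_combination_spread:
  fixes \<psi> p :: "'d::finite \<Rightarrow> real"
  assumes p: "\<And>j. \<epsilon> \<le> p j" and sum1: "(\<Sum>j\<in>UNIV. p j) = 1" and "0 \<le> \<epsilon>"
  shows "(1 - \<epsilon>) * Min (range \<psi>) + \<epsilon> * Max (range \<psi>) \<le> (\<Sum>j\<in>UNIV. p j * \<psi> j)"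
    and "(\<Sum>j\<in>UNIV. p j * \<psi> j) \<le> (1 - \<epsilon>) * Max (range \<psi>) + \<epsilon> * Min (range \<psi>)"
proof -
  let ?M = "Max (range \<psi>)" and ?m = "Min (range \<psi>)"
  have b: "?m \<le> \<psi> j" "\<psi> j \<le> ?M" for j by auto
  have "?M \<in> range \<psi>" "?m \<in> range \<psi>" by (auto intro!: Max_in Min_in)
  then obtain u v where u: "\<psi> u = ?M" and v: "\<psi> v = ?m" by (metis imageE)
  have p0: "0 \<le> p j" for j using p[of j] \<open>0 \<le> \<epsilon>\<close> by simp
  have "\<epsilon> * (?M - ?m) \<le> p u * (\<psi> u - ?m)"
    using p[of u] b[of u] by (simp add: u mult_right_mono)
  also have "\<dots> \<le> (\<Sum>j\<in>UNIV. p j * (\<psi> j - ?m))"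
    by (rule member_le_sum) (use p0 b in auto)
  also have "\<dots> = (\<Sum>j\<in>UNIV. p j * \<psi> j) - ?m"
    by (simp add: right_diff_distrib sum_subtractf sum_distrib_right[symmetric] sum1)
  finally show "(1 - \<epsilon>) * ?m + \<epsilon> * ?M \<le> (\<Sum>j\<in>UNIV. p j * \<psi> j)"
    by (simp add: algebra_simps)
  have "\<epsilon> * (?M - ?m) \<le> p v * (?M - \<psi> v)"
    using p[of v] b[of v] by (simp add: v mult_right_mono)
  also have "\<dots> \<le> (\<Sum>j\<in>UNIV. p j * (?M - \<psi> j))"
    by (rule member_le_sum) (use p0 b in auto)
  also have "\<dots> = ?M - (\<Sum>j\<in>UNIV. p j * \<psi> j)"
    by (simp add: right_diff_distrib sum_subtractf sum_distrib_right[symmetric] sum1)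
  finally show "(\<Sum>j\<in>UNIV. p j * \<psi> j) \<le> (1 - \<epsilon>) * ?M + \<epsilon> * ?m"
    by (simp add: algebra_simps)
qed

text \<open>The spread \<open>D\<close> loses a fixed proportion at each step up to a summable
  error, so \<open>D\<close> is summable; it controls the increments of each component.\<close>

lemma perturbed_positive_averaging_convergent:
  fixes \<phi> :: "nat \<Rightarrow> 'd::finite \<Rightarrow> real" and P :: "nat \<Rightarrow> 'd \<Rightarrow> 'd \<Rightarrow> real"
  assumes eps: "0 < \<epsilon>" and P: "\<And>n i j. \<epsilon> \<le> P n i j" and sum1: "\<And>n i. (\<Sum>j\<in>UNIV. P n i j) = 1"
    and step: "\<And>n i. \<bar>\<phi> (Suc n) i - (\<Sum>j\<in>UNIV. P n i j * \<phi> n j)\<bar> \<le> \<delta> n"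
    and \<delta>: "summable \<delta>"
  shows "convergent (\<lambda>n. \<phi> n i)"
proof -
  define M where "M n = Max (range (\<phi> n))" for n
  define m where "m n = Min (range (\<phi> n))" for n
  define D where "D n = M n - m n" for n
  have b: "m n \<le> \<phi> n i" "\<phi> n i \<le> M n" for n i by (auto simp: m_def M_def)
  have \<delta>0: "0 \<le> \<delta> n" for n using step[of n undefined] by linarith
  have D0: "0 \<le> D n" for n using b[of n undefined] by (simp add: D_def)
  have lo: "(1 - \<epsilon>) * m n + \<epsilon> * M n \<le> (\<Sum>j\<in>UNIV. P n i j * \<phi> n j)"
    and up: "(\<Sum>j\<in>UNIV. P n i j * \<phi> n j) \<le> (1 - \<epsilon>) * M n + \<epsilon> * m n" for n i
    using convex_combination_spread[where p = "P n i" and \<psi> = "\<phi> n", OF P sum1] eps by (simp_all add: m_def M_def)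
  \<comment> \<open>The contraction is applied to the maximum; for the minimum it is enough that it
    falls by at most \<open>\<delta> n\<close>.\<close>
  have drop: "\<epsilon> * D n \<le> D n - D (Suc n) + 2 * \<delta> n" for n
  proof -
    have "M (Suc n) \<le> (1 - \<epsilon>) * M n + \<epsilon> * m n + \<delta> n"
      unfolding M_def[of "Suc n"] using step[of n] up[of n] by (auto simp: Max_le_iff) (smt (verit))
    moreover have "m n - \<delta> n \<le> m (Suc n)"
    proof -
      have "m n \<le> (1 - \<epsilon>) * m n + \<epsilon> * M n"
        using D0[of n] eps by (simp add: D_def algebra_simps)
      then show ?thesis
        unfolding m_def[of "Suc n"] using step[of n] lo[of n] by (auto simp: Min_ge_iff) (smt (verit))
    qed
    ultimately show ?thesis by (simp add: D_def algebra_simps)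
  qed
  have "(\<Sum>l<n. \<epsilon> * D l) \<le> D 0 + 2 * suminf \<delta>" for n
  proof -
    have "(\<Sum>l<n. \<epsilon> * D l) \<le> (\<Sum>l<n. D l - D (Suc l) + 2 * \<delta> l)"
      by (rule sum_mono) (rule drop)
    also have "\<dots> = D 0 - D n + 2 * (\<Sum>l<n. \<delta> l)"
      by (simp add: sum.distrib sum_lessThan_telescope' sum_distrib_left)
    also have "\<dots> \<le> D 0 + 2 * suminf \<delta>"
      using D0[of n] sum_le_suminf[OF \<delta>, of "{..<n}"] \<delta>0 by simp
    finally show ?thesis .
  qed
  then have "summable (\<lambda>l. \<epsilon> * D l)"
    using D0 eps by (intro summableI_nonneg_bounded) auto
  then have sD: "summable D" using eps by (simp add: summable_cmult_iff)
  \<comment> \<open>The old value and the exact average both lie between \<open>m n\<close> and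
    \<open>M n\<close>.\<close>
  have "\<bar>\<phi> (Suc n) i - \<phi> n i\<bar> \<le> D n + \<delta> n" for n
  proof -
    have "\<epsilon> * m n \<le> \<epsilon> * M n" using D0[of n] eps by (simp add: D_def)
    then have "m n \<le> (\<Sum>j\<in>UNIV. P n i j * \<phi> n j)" "(\<Sum>j\<in>UNIV. P n i j * \<phi> n j) \<le> M n"
      using lo[where n = n and i = i] up[where n = n and i = i] by (simp_all add: algebra_simps)
    then show ?thesis using step[of n i] b[of n i] by (simp add: D_def)
  qed
  then have "summable (\<lambda>n. \<phi> (Suc n) i - \<phi> n i)"
    by (intro summable_comparison_test'[OF summable_add[OF sD \<delta>]]) auto
  then have "convergent (\<lambda>n. \<phi> n i - \<phi> 0 i)"
    unfolding summable_iff_convergent sum_lessThan_telescope[of "\<lambda>n. \<phi> n i"] .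
  then show ?thesis by (simp add: convergent_diff_const_right_iff)
qed

text \<open>Tightness yields a weak limit along a subsequence. Its characteristic function must be
  the pointwise limit of the whole sequence, so Levy's continuity theorem applies to the whole
  sequence.\<close>

lemma weakly_convergent_if_char_convergent:
  fixes R :: "nat \<Rightarrow> real measure"
  assumes tight: "tight R" and conv: "\<And>t. convergent (\<lambda>n. char (R n) t)"
  obtains M where "real_distribution M" "weak_conv_m R M"
proof -
  obtain r M where r: "strict_mono (r :: nat \<Rightarrow> nat)" and M: "real_distribution M" "weak_conv_m (R \<circ> r) M"
    using tight_imp_convergent_subsubsequence[OF tight strict_mono_id] by auto
  have R: "real_distribution (R n)" for n using tight by (simp add: tight_def)
  have "(\<lambda>n. char (R n) t) \<longlonglongrightarrow> char M t" for t
  proof -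
    obtain c where c: "(\<lambda>n. char (R n) t) \<longlonglongrightarrow> c" using conv[of t] by (auto simp: convergent_def)
    have "(\<lambda>n. char ((R \<circ> r) n) t) \<longlonglongrightarrow> c"
      using LIMSEQ_subseq_LIMSEQ[OF c r] by (simp add: o_def)
    moreover have "(\<lambda>n. char ((R \<circ> r) n) t) \<longlonglongrightarrow> char M t"
      by (rule levy_continuity1[OF _ M]) (simp add: R)
    ultimately show ?thesis using c LIMSEQ_unique by blast
  qed
  then have "weak_conv_m R M" by (intro levy_continuity R M)
  with M that show ?thesis by blast
qed

text \<open>Splits off the last base \<open>k\<close> digit, matching the form of the digit
  recursion.\<close>

lemma sum_lessThan_mult:
  fixes g :: "nat \<Rightarrow> 'a::comm_monoid_add"
  shows "(\<Sum>m<k * N. g m) = (\<Sum>m<N. \<Sum>a<k. g (k * m + a))"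
proof -
  have "(\<Sum>m<k * N. g m) = (\<Sum>m<N. sum g {m * k..<m * k + k})"
    by (simp add: sum.nat_group mult.commute)
  also have "\<dots> = (\<Sum>m<N. \<Sum>a<k. g (k * m + a))"
    by (rule sum.cong[OF refl], subst sum.atLeastLessThan_shift_0) (simp add: atLeast0LessThan mult.commute)
  finally show ?thesis .
qed

lemma sum_const_to_torus: "(\<Sum>_<r. to_torus y) = to_torus (real r * y)"
proof (induction r)
  case 0
  have "to_torus 0 = 0" by transfer simp
  then show ?case by simp
next
  case (Suc r)
  then show ?case by (simp add: to_torus_add[symmetric] algebra_simps)
qed

section \<open>The measures of a primitive sequence\<close>

text \<open>Collects what primitivity gives for the analysis. The nonzero value is required at some
  \<open>m\<close> at least 1 because no block from \<open>k ^ n\<close> to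
  \<open>k ^ (n + 1) - 1\<close> contains 0.\<close>

locale positive_recursion =
  fixes k :: nat and F :: "'d::finite \<Rightarrow> nat \<Rightarrow> int" and B :: "nat \<Rightarrow> int ^ 'd ^ 'd"
  assumes k_ge_2: "k \<ge> 2"
    and F_nonneg: "F i m \<ge> 0"
    and F_rec: "a < k \<Longrightarrow> F i (k * m + a) = (\<Sum>j\<in>UNIV. B a $ i $ j * F j m)"
    and B_nonneg: "a < k \<Longrightarrow> B a $ i $ j \<ge> 0"
    and B_pos: "(\<Sum>a<k. B a $ i $ j) > 0"
    and F_nonzero: "\<exists>m\<ge>1. \<exists>i. F i m \<noteq> 0"
begin

section \<open>Block sums and their positivity\<close>

definition len :: "nat \<Rightarrow> nat" where "len n = k ^ (n + 1) - k ^ n"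

lemma len_pos: "0 < len n"
  using k_ge_2 by (simp add: len_def)

lemma len_Suc: "len (Suc n) = k * len n"
  by (simp add: len_def algebra_simps)

lemma Sig_eq: "Sig k F i n = (\<Sum>m<len n. F i (k ^ n + m))"
proof -
  have "{a..q - 1} = {a..<q}" if "a < q" for a q :: nat using that by auto
  then have "{k ^ n..k ^ (n + 1) - 1} = {k ^ n..<k ^ (n + 1)}"
    using k_ge_2 by simp
  then have "Sig k F i n = sum (F i) {k ^ n..<k ^ (n + 1)}"
    unfolding Sig_def by simp
  then show ?thesis
    by (subst (asm) sum.atLeastLessThan_shift_0) (simp add: atLeast0LessThan len_def)
qed

lemma Sig_nonneg: "0 \<le> Sig k F i n"
  by (simp add: Sig_eq F_nonneg sum_nonneg)

definition b :: "'d \<Rightarrow> 'd \<Rightarrow> int" where "b i j = (\<Sum>a<k. B a $ i $ j)"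

text \<open>Integrality turns positivity into a uniform lower bound.\<close>

lemma b_ge_1: "1 \<le> b i j"
  using B_pos[of i j] by (simp add: b_def)

lemma Sig_Suc: "Sig k F i (Suc n) = (\<Sum>j\<in>UNIV. b i j * Sig k F j n)"
proof -
  have "Sig k F i (Suc n) = (\<Sum>m<len n. \<Sum>a<k. F i (k * (k ^ n + m) + a))"
    by (simp add: Sig_eq len_Suc sum_lessThan_mult algebra_simps)
  also have "\<dots> = (\<Sum>m<len n. \<Sum>a<k. \<Sum>j\<in>UNIV. B a $ i $ j * F j (k ^ n + m))"
    by (intro sum.cong refl F_rec) simp
  also have "\<dots> = (\<Sum>m<len n. \<Sum>j\<in>UNIV. b i j * F j (k ^ n + m))"
    by (subst sum.swap) (simp add: b_def sum_distrib_right)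
  also have "\<dots> = (\<Sum>j\<in>UNIV. b i j * Sig k F j n)"
    by (subst sum.swap) (simp add: Sig_eq sum_distrib_left)
  finally show ?thesis .
qed

text \<open>If all sums at level 0 vanished, every \<open>F j\<close> would vanish at 1, ...,
  \<open>k - 1\<close>, and the recursion from \<open>m div k\<close> to \<open>m\<close> would
  carry this to all \<open>m\<close> at least 1.\<close>

lemma ex_Sig_0_pos: "\<exists>j. 0 < Sig k F j 0"
proof (rule ccontr)
  assume "\<nexists>j. 0 < Sig k F j 0"
  then have "Sig k F j 0 = 0" for j using Sig_nonneg[of j 0] by (auto simp: not_less intro: antisym)
  \<comment> \<open>Block 0 starts at \<open>k ^ 0 = 1\<close>, so the offset \<open>m\<close>
    stands for the argument \<open>Suc m\<close>.\<close>
  then have base: "F j (Suc m) = 0" if "m < len 0" for j m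
    using that by (simp add: Sig_eq sum_nonneg_eq_0_iff F_nonneg)
  have "F j m = 0" if "m \<ge> 1" for j m
    using that
  proof (induction m arbitrary: j rule: less_induct)
    case (less m)
    show ?case
    proof (cases "m < k")
      case True
      then show ?thesis using base[of "m - 1" j] less.prems by (simp add: len_def)
    next
      case False
      then have "m div k \<ge> 1" "m div k < m" using k_ge_2 by (auto simp: div_greater_zero_iff Suc_le_eq)
      then have "F i (m div k) = 0" for i using less.IH by blast
      moreover have "F j m = F j (k * (m div k) + m mod k)" by simp
      moreover have "m mod k < k" using k_ge_2 by simp
      ultimately show ?thesis by (simp only: F_rec) simp
    qed
  qed
  then show False using F_nonzero by blast
qed

text \<open>One positive component at level 0 makes all components positive at level 1, since every
  \<open>b i j\<close> is positive. Level 0 itself may contain zeros, hence the shift by one here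
  and below.\<close>

lemma Sig_Suc_pos: "0 < Sig k F i (Suc n)"
proof (induction n arbitrary: i)
  case 0
  obtain j where j: "0 < Sig k F j 0" using ex_Sig_0_pos by blast
  have "0 < b i j * Sig k F j 0" using j b_ge_1[of i j] by simp
  also have "\<dots> \<le> Sig k F i (Suc 0)"
    unfolding Sig_Suc using b_ge_1 Sig_nonneg
    by (intro member_le_sum) (auto intro!: mult_nonneg_nonneg intro: order_trans[OF zero_le_one])
  finally show ?case .
next
  case (Suc n)
  have "0 < b i j * Sig k F j (Suc n)" for j
    using Suc[of j] b_ge_1[of i j] by simp
  then show ?case
    unfolding Sig_Suc[of i "Suc n"] by (intro sum_pos) auto
qed

section \<open>Weights, nodes and the refinement step\<close>

definition w :: "nat \<Rightarrow> 'd \<Rightarrow> nat \<Rightarrow> real" where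
  "w n i m = real_of_int (F i (k ^ n + m)) / real_of_int (Sig k F i n)"

text \<open>The index is shifted: \<open>A n\<close> holds the coefficients of
  \<open>A_poly k F B (Suc n)\<close>.\<close>

definition A :: "nat \<Rightarrow> 'd \<Rightarrow> 'd \<Rightarrow> nat \<Rightarrow> real" where
  "A n i j a = real_of_int (Sig k F j n) / real_of_int (Sig k F i (Suc n)) * real_of_int (B a $ i $ j)"

text \<open>The points \<open>m / len n\<close>, kept on the real line so that distances and
  characteristic functions make sense.\<close>

definition node :: "nat \<Rightarrow> nat \<Rightarrow> real" where
  "node n m = real m / (real k ^ n * (real k - 1))"

lemma w_nonneg: "0 \<le> w n i m"
  by (simp add: w_def F_nonneg Sig_nonneg)

lemma A_nonneg: "a < k \<Longrightarrow> 0 \<le> A n i j a"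
  by (simp add: A_def B_nonneg Sig_nonneg)

lemma sum_w: "(\<Sum>m<len (Suc n). w (Suc n) i m) = 1"
proof -
  have "(\<Sum>m<len (Suc n). real_of_int (F i (k ^ Suc n + m))) = Sig k F i (Suc n)"
    unfolding Sig_eq by simp
  then show ?thesis
    using Sig_Suc_pos[of i n] unfolding w_def sum_divide_distrib[symmetric] by simp
qed

text \<open>The digit recursion after normalisation: each child's weight mixes the weights of its
  parent.\<close>

lemma w_Suc:
  assumes "m < len n" "a < k"
  shows "w (Suc n) i (k * m + a) = (\<Sum>j\<in>UNIV. A n i j a * w n j m)"
proof -
  \<comment> \<open>If \<open>\<Sigma>\<^sub>j(n) = 0\<close>, the division in \<open>w\<close> yields 0, but then all \<open>F\<^sub>j\<close> in the block vanish as well.\<close>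
  have cancel: "real_of_int (Sig k F j n) * w n j m = real_of_int (F j (k ^ n + m))" for j
  proof (cases "Sig k F j n = 0")
    case True
    then have "F j (k ^ n + m) = 0"
      using assms by (simp add: Sig_eq sum_nonneg_eq_0_iff F_nonneg)
    then show ?thesis by (simp add: w_def)
  qed (simp add: w_def)
  have "(\<Sum>j\<in>UNIV. A n i j a * w n j m)
      = (\<Sum>j\<in>UNIV. B a $ i $ j * (Sig k F j n * w n j m) / Sig k F i (Suc n))"
    by (intro sum.cong refl) (simp add: A_def)
  also have "\<dots> = real_of_int (F i (k * (k ^ n + m) + a)) / Sig k F i (Suc n)"
    unfolding cancel F_rec[OF assms(2)] by (simp add: sum_divide_distrib)
  finally show ?thesis by (simp add: w_def algebra_simps)
qed

text \<open>A child is its parent translated by the position of the atom belonging to the digit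
  \<open>a\<close>; this is why refinement is a convolution.\<close>

lemma node_Suc: "node (Suc n) (k * m + a) = real a / (real k ^ Suc n * (real k - 1)) + node n m"
proof -
  define d where "d = real k ^ n * (real k - 1)"
  have "d \<noteq> 0" using k_ge_2 by (simp add: d_def)
  then have "real (k * m + a) / (real k * d) = real a / (real k * d) + real m / d"
    using k_ge_2 by (simp add: field_simps)
  then show ?thesis by (simp add: node_def d_def mult.assoc)
qed

lemma node_bounds: "m < len n \<Longrightarrow> 0 \<le> node n m \<and> node n m \<le> 1"
proof -
  assume "m < len n"
  then have "real m \<le> real (k ^ n * (k - 1))" unfolding of_nat_le_iff by (simp add: len_def algebra_simps)
  then show ?thesis using k_ge_2 by (simp add: node_def of_nat_diff)
qed

lemma mu_eq: "mu k F n $ i = point_masses (w n i) (\<lambda>m. to_torus (node n m)) {..<len n}"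
proof -
  have "{0..k ^ (n + 1) - k ^ n - 1} = {..<len n}"
    using len_pos[of n] unfolding len_def[symmetric] by auto
  then show ?thesis unfolding mu_def point_masses_def w_def node_def by simp
qed

lemma torus_finite_mu: "torus_finite (mu k F n $ i)"
  by (simp add: mu_eq torus_finite_point_masses)

lemma torus_finite_A_dirac: "torus_finite (A_dirac k F B n $ i $ j)"
  by (simp add: A_dirac_def poly_dirac_def point_masses_def[symmetric] torus_finite_point_masses)

lemma coeff_A_poly: "coeff (A_poly k F B (Suc n) $ i $ j) a = (if a < k then A n i j a else 0)"
  by (simp add: A_poly_def B_poly_def A_def coeff_map_poly coeff_sum)

text \<open>\<open>poly_dirac\<close> sums up to the degree, which may be below
  \<open>k - 1\<close>; coefficients outside the common index range vanish.\<close>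

lemma A_dirac_eq:
  "A_dirac k F B (Suc n) $ i $ j
    = point_masses (A n i j) (\<lambda>a. to_torus (real a / (real k ^ Suc n * (real k - 1)))) {..<k}"
    (is "?L = point_masses _ ?h _")
proof (rule torus_measure_eqI)
  fix X :: "torus set" assume [measurable]: "X \<in> sets borel"
  let ?p = "A_poly k F B (Suc n) $ i $ j"
  have L: "?L = point_masses (coeff ?p) ?h {..degree ?p}"
    by (simp add: A_dirac_def poly_dirac_def point_masses_def sum_const_to_torus)
  have "(\<Sum>a\<le>degree ?p. ennreal (coeff ?p a) * indicator X (?h a))
      = (\<Sum>a\<in>{..degree ?p} \<inter> {..<k}. ennreal (coeff ?p a) * indicator X (?h a))"
    by (intro sum.mono_neutral_right) (auto simp: coeff_A_poly)
  also have "\<dots> = (\<Sum>a<k. ennreal (coeff ?p a) * indicator X (?h a))"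
  proof (intro sum.mono_neutral_left ballI)
    fix a assume "a \<in> {..<k} - {..degree ?p} \<inter> {..<k}"
    then have "coeff ?p a = 0" by (auto intro: coeff_eq_0)
    then show "ennreal (coeff ?p a) * indicator X (?h a) = 0" by simp
  qed auto
  also have "\<dots> = (\<Sum>a<k. ennreal (A n i j a) * indicator X (?h a))"
    by (intro sum.cong refl) (simp add: coeff_A_poly)
  finally show "(\<integral>\<^sup>+z. indicator X z \<partial>?L) = (\<integral>\<^sup>+z. indicator X z \<partial>point_masses (A n i j) ?h {..<k})"
    unfolding L by (simp add: nn_integral_point_masses del: nn_integral_indicator)
qed (simp_all add: torus_finiteD(1)[OF torus_finite_A_dirac])

lemma mconv_mv_A_dirac_mu: "mconv_mv (A_dirac k F B (Suc n)) (mu k F n) = mu k F (Suc n)"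
proof (rule vec_eq_iff[THEN iffD2, rule_format], rule torus_measure_eqI)
  fix i and X :: "torus set" assume [measurable]: "X \<in> sets borel"
  let ?h = "\<lambda>a. to_torus (real a / (real k ^ Suc n * (real k - 1)))"
  have m: "(\<lambda>y. indicator X (z + y) :: ennreal) \<in> borel_measurable borel" for z
    by simp
  have m2: "(\<lambda>z. \<Sum>m<len n. ennreal (w n j m) * indicator X (z + to_torus (node n m)))
      \<in> borel_measurable borel" for j
    by measurable
  have "(\<integral>\<^sup>+z. indicator X z \<partial>(mconv_mv (A_dirac k F B (Suc n)) (mu k F n) $ i))
    = (\<Sum>j\<in>UNIV. \<Sum>a<k. ennreal (A n i j a) *
        (\<Sum>m<len n. ennreal (w n j m) * indicator X (?h a + to_torus (node n m))))"
    by (subst nn_integral_mconv_mv[OF torus_finite_A_dirac torus_finite_mu])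
       (simp_all only: A_dirac_eq mu_eq nn_integral_point_masses finite_lessThan m m2
         borel_measurable_indicator \<open>X \<in> sets borel\<close>)
  also have "\<dots> = (\<Sum>j\<in>UNIV. \<Sum>a<k. \<Sum>m<len n.
      ennreal (A n i j a * w n j m) * indicator X (to_torus (node (Suc n) (k * m + a))))"
    by (simp only: sum_distrib_left, intro sum.cong refl)
       (simp add: ennreal_mult A_nonneg w_nonneg node_Suc to_torus_add mult.assoc)
  \<comment> \<open>The sum over \<open>j\<close> is moved innermost in two exchanges, so that
    \<open>w_Suc\<close> can evaluate it.\<close>
  also have "\<dots> = (\<Sum>j\<in>UNIV. \<Sum>m<len n. \<Sum>a<k.
      ennreal (A n i j a * w n j m) * indicator X (to_torus (node (Suc n) (k * m + a))))"
    by (rule sum.cong[OF refl], rule sum.swap)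
  also have "\<dots> = (\<Sum>m<len n. \<Sum>a<k. \<Sum>j\<in>UNIV.
      ennreal (A n i j a * w n j m) * indicator X (to_torus (node (Suc n) (k * m + a))))"
    by (subst sum.swap, intro sum.cong refl, rule sum.swap)
  also have "\<dots> = (\<Sum>m<len n. \<Sum>a<k.
      ennreal (w (Suc n) i (k * m + a)) * indicator X (to_torus (node (Suc n) (k * m + a))))"
    by (intro sum.cong refl)
       (simp add: w_Suc sum_distrib_right[symmetric] sum_ennreal A_nonneg w_nonneg)
  also have "\<dots> = (\<integral>\<^sup>+z. indicator X z \<partial>(mu k F (Suc n) $ i))"
    by (simp add: mu_eq nn_integral_point_masses len_Suc sum_lessThan_mult del: nn_integral_indicator)
  finally show "(\<integral>\<^sup>+z. indicator X z \<partial>(mconv_mv (A_dirac k F B (Suc n)) (mu k F n) $ i))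
    = (\<integral>\<^sup>+z. indicator X z \<partial>(mu k F (Suc n) $ i))" .
qed (simp_all add: torus_finiteD(1)[OF torus_finite_mu])

lemma mconv_prod_A_dirac_mu: "mconv_mv (mconv_prod (A_dirac k F B) N) (mu k F 0) = mu k F N"
proof (induction N)
  case 0
  then show ?case by (simp add: mconv_mv_one torus_finite_mu)
next
  case (Suc N)
  then show ?case
    by (simp only: mconv_prod_mv_Suc torus_finite_A_dirac torus_finite_mu mconv_mv_A_dirac_mu)
qed

section \<open>Row-stochastic matrices with uniformly positive entries\<close>

definition P :: "nat \<Rightarrow> 'd \<Rightarrow> 'd \<Rightarrow> real" where "P n i j = (\<Sum>a<k. A n i j a)"

lemma P_eq: "P n i j = real_of_int (b i j * Sig k F j n) / real_of_int (Sig k F i (Suc n))"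
  by (simp add: P_def A_def b_def sum_distrib_left sum_divide_distrib mult.commute)

lemma sum_P: "(\<Sum>j\<in>UNIV. P n i j) = 1"
  using Sig_Suc_pos[of i n]
  by (simp add: P_eq sum_divide_distrib[symmetric] of_int_sum[symmetric] Sig_Suc[symmetric]
      del: of_int_sum of_int_mult)

text \<open>With \<open>?S\<close> the total at level \<open>n\<close>, every component at level
  \<open>n + 1\<close> lies between \<open>?S\<close> and \<open>C * ?S\<close>, and every component
  at level \<open>n + 2\<close> is at most \<open>C * C * ?S\<close>.\<close>

lemma P_lower_bound: "\<exists>\<epsilon>>0. \<forall>n i j. \<epsilon> \<le> P (Suc n) i j"
proof -
  \<comment> \<open>The sum of all entries bounds both single entries and row sums.\<close>
  define C where "C = (\<Sum>i\<in>UNIV. \<Sum>j\<in>UNIV. b i j)"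
  have b0: "0 \<le> b i j" for i j using b_ge_1[of i j] by simp
  have row: "(\<Sum>j\<in>UNIV. b i j) \<le> C" for i
    unfolding C_def by (rule member_le_sum) (auto intro: sum_nonneg b0)
  have bC: "b i j \<le> C" for i j
    using member_le_sum[of j UNIV "b i"] b0 row[of i] by force
  have C0: "0 < C" using bC b_ge_1 by (meson less_le_trans zero_less_one)
  have "1 / (real_of_int C)\<^sup>2 \<le> P (Suc n) i j" for n i j
  proof -
    let ?S = "\<Sum>l\<in>UNIV. Sig k F l n"
    have up: "Sig k F l (Suc n) \<le> C * ?S" for l
      unfolding Sig_Suc sum_distrib_left
      by (intro sum_mono mult_right_mono bC Sig_nonneg)
    have lo: "?S \<le> Sig k F j (Suc n)"
      unfolding Sig_Suc using mult_right_mono[OF b_ge_1 Sig_nonneg] by (auto intro!: sum_mono)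
    have "Sig k F i (Suc (Suc n)) \<le> (\<Sum>l\<in>UNIV. b i l * (C * ?S))"
      unfolding Sig_Suc[of i "Suc n"] by (intro sum_mono mult_left_mono up b0)
    also have "\<dots> \<le> C * (C * ?S)"
      unfolding sum_distrib_right[symmetric]
      using C0 by (intro mult_right_mono row) (simp add: sum_nonneg Sig_nonneg)
    also have "\<dots> \<le> C * (C * Sig k F j (Suc n))"
      using lo C0 by simp
    also have "\<dots> \<le> C * (C * (b i j * Sig k F j (Suc n)))"
    proof -
      have "1 * Sig k F j (Suc n) \<le> b i j * Sig k F j (Suc n)"
        by (intro mult_right_mono b_ge_1 Sig_nonneg)
      then show ?thesis using C0 by simp
    qed
    finally have "real_of_int (Sig k F i (Suc (Suc n)))
        \<le> (real_of_int C)\<^sup>2 * real_of_int (b i j * Sig k F j (Suc n))"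
      unfolding power2_eq_square of_int_mult[symmetric] of_int_le_iff by (simp add: mult.assoc)
    then show ?thesis
      using C0 Sig_Suc_pos[of i "Suc n"] unfolding P_eq by (simp add: field_simps)
  qed
  then show ?thesis using C0 by (intro exI[of _ "1 / (real_of_int C)\<^sup>2"]) simp
qed

section \<open>Convergence of integrals of Lipschitz functions\<close>

definition \<phi> :: "(real \<Rightarrow> real) \<Rightarrow> nat \<Rightarrow> 'd \<Rightarrow> real" where
  "\<phi> g n i = (\<Sum>m<len n. w n i m * g (node n m))"

text \<open>Evaluating \<open>g\<close> at the parent instead of the child gives exactly the average
  by \<open>P n\<close>. The error is at most the Lipschitz bound for the distance from child to
  parent, as the weights sum to 1.\<close>

lemma \<phi>_step:
  assumes lip: "\<And>u v. \<bar>g u - g v\<bar> \<le> L * \<bar>u - v\<bar>"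
  shows "\<bar>\<phi> g (Suc n) i - (\<Sum>j\<in>UNIV. P n i j * \<phi> g n j)\<bar> \<le> L * (1 / real k) ^ Suc n"
proof -
  have L0: "0 \<le> L" using lip[of 1 0] by simp
  have close: "\<bar>g (node (Suc n) (k * m + a)) - g (node n m)\<bar> \<le> L * (1 / real k) ^ Suc n" if "a < k" for m a
  proof -
    have "real a / (real k - 1) \<le> 1" using that k_ge_2 by simp
    then have "real a / (real k - 1) * (1 / real k) ^ Suc n \<le> 1 * (1 / real k) ^ Suc n"
      by (rule mult_right_mono) simp
    moreover have "node (Suc n) (k * m + a) - node n m = real a / (real k - 1) * (1 / real k) ^ Suc n"
      unfolding node_Suc by (simp add: power_one_over mult.commute)
    moreover have "0 \<le> real a / (real k - 1) * (1 / real k) ^ Suc n"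
      using k_ge_2 by simp
    ultimately have "\<bar>node (Suc n) (k * m + a) - node n m\<bar> \<le> (1 / real k) ^ Suc n"
      by linarith
    then show ?thesis
      using lip[of "node (Suc n) (k * m + a)" "node n m"] by (blast intro: order_trans mult_left_mono[OF _ L0])
  qed
  have "(\<Sum>j\<in>UNIV. P n i j * \<phi> g n j) = (\<Sum>j\<in>UNIV. \<Sum>m<len n. \<Sum>a<k. A n i j a * w n j m * g (node n m))"
    by (simp add: P_def \<phi>_def sum_distrib_left sum_distrib_right mult.assoc)
  also have "\<dots> = (\<Sum>m<len n. \<Sum>a<k. \<Sum>j\<in>UNIV. A n i j a * w n j m * g (node n m))"
    by (subst sum.swap, intro sum.cong refl, rule sum.swap)
  also have "\<dots> = (\<Sum>m<len n. \<Sum>a<k. w (Suc n) i (k * m + a) * g (node n m))"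
    by (simp add: w_Suc sum_distrib_right)
  finally have diff: "\<phi> g (Suc n) i - (\<Sum>j\<in>UNIV. P n i j * \<phi> g n j)
      = (\<Sum>m<len n. \<Sum>a<k. w (Suc n) i (k * m + a) * (g (node (Suc n) (k * m + a)) - g (node n m)))"
    by (simp add: \<phi>_def len_Suc sum_lessThan_mult right_diff_distrib sum_subtractf)
  have "\<bar>\<phi> g (Suc n) i - (\<Sum>j\<in>UNIV. P n i j * \<phi> g n j)\<bar>
      \<le> (\<Sum>m<len n. \<Sum>a<k. w (Suc n) i (k * m + a) * (L * (1 / real k) ^ Suc n))"
    unfolding diff
  proof (intro order_trans[OF sum_abs] sum_mono)
    fix m a assume "a \<in> {..<k}"
    then show "\<bar>w (Suc n) i (k * m + a) * (g (node (Suc n) (k * m + a)) - g (node n m))\<bar>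
        \<le> w (Suc n) i (k * m + a) * (L * (1 / real k) ^ Suc n)"
      unfolding abs_mult abs_of_nonneg[OF w_nonneg] by (intro mult_left_mono close w_nonneg) simp
  qed
  also have "\<dots> = L * (1 / real k) ^ Suc n"
    using sum_w[of n i] unfolding len_Suc sum_lessThan_mult sum_distrib_right[symmetric] by simp
  finally show ?thesis .
qed

lemma \<phi>_convergent:
  assumes "\<And>u v. \<bar>g u - g v\<bar> \<le> L * \<bar>u - v\<bar>"
  shows "convergent (\<lambda>n. \<phi> g (Suc n) i)"
proof -
  obtain \<epsilon> where \<epsilon>: "0 < \<epsilon>" "\<And>n i j. \<epsilon> \<le> P (Suc n) i j" using P_lower_bound by blast
  have "summable (\<lambda>n. L * (1 / real k)\<^sup>2 * (1 / real k) ^ n)"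
    using k_ge_2 by (intro summable_mult summable_geometric) simp
  then have "summable (\<lambda>n. L * (1 / real k) ^ Suc (Suc n))"
    by (simp add: power2_eq_square mult.assoc)
  then show ?thesis
    by (intro perturbed_positive_averaging_convergent[where P = "\<lambda>n. P (Suc n)"
          and \<phi> = "\<lambda>n. \<phi> g (Suc n)", OF \<epsilon> sum_P \<phi>_step[OF assms]])
qed

section \<open>Lifted measures on the real line and the weak limit\<close>

definition R :: "nat \<Rightarrow> 'd \<Rightarrow> real measure" where
  "R n i = distr (point_measure {..<len n} (\<lambda>m. ennreal (w n i m))) borel (node n)"

lemma mu_eq_distr_R: "mu k F n $ i = distr (R n i) borel to_torus"
  unfolding mu_eq R_def by (rule point_masses_eq_distr) simp_all

lemma prob_space_point_measure_w: "prob_space (point_measure {..<len (Suc n)} (\<lambda>m. ennreal (w (Suc n) i m)))"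
  by (rule prob_space_point_measure) (simp_all add: w_nonneg sum_ennreal sum_w)

lemma real_distribution_R: "real_distribution (R (Suc n) i)"
  unfolding R_def real_distribution_def real_distribution_axioms_def
  by (auto intro!: prob_space.prob_space_distr[OF prob_space_point_measure_w])

text \<open>All nodes lie in the unit interval. The left end -1 keeps the node 0 inside the
  half-open interval.\<close>

lemma tight_R: "tight (\<lambda>n. R (Suc n) i)"
  unfolding tight_def
proof (intro conjI allI impI real_distribution_R)
  fix \<epsilon> :: real assume "0 < \<epsilon>"
  have "measure (R (Suc n) i) {-1<..1} = 1" for n
  proof -
    interpret prob_space "point_measure {..<len (Suc n)} (\<lambda>m. ennreal (w (Suc n) i m))"
      by (rule prob_space_point_measure_w)
    have "node (Suc n) -` {-1<..1} \<inter> {..<len (Suc n)} = {..<len (Suc n)}"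
      using node_bounds[of _ "Suc n"] by force
    then show ?thesis
      using prob_space by (simp add: R_def measure_distr space_point_measure)
  qed
  then show "\<exists>a b. a < b \<and> (\<forall>n. 1 - \<epsilon> < measure (R (Suc n) i) {a<..b})"
    using \<open>0 < \<epsilon>\<close> by (intro exI[of _ "-1"] exI[of _ 1]) simp
qed

lemma char_R: "char (R n i) t = Complex (\<phi> (\<lambda>u. cos (t * u)) n i) (\<phi> (\<lambda>u. sin (t * u)) n i)"
proof -
  have "char (R n i) t = (\<integral>m. iexp (t * node n m) \<partial>point_measure {..<len n} (\<lambda>m. ennreal (w n i m)))"
    unfolding R_def char_def by (rule integral_distr) simp_all
  also have "\<dots> = (\<Sum>m<len n. w n i m *\<^sub>R iexp (t * node n m))"
    by (rule lebesgue_integral_point_measure_finite) (simp_all add: w_nonneg)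
  finally show ?thesis
    by (simp add: complex_eq_iff \<phi>_def Re_exp Im_exp)
qed

lemma convergent_char_R: "convergent (\<lambda>n. char (R (Suc n) i) t)"
proof -
  \<comment> \<open>The Lipschitz constant \<open>\<bar>t\<bar>\<close> comes from the
    sum-to-product formulas and \<open>\<bar>sin x\<bar> \<le> \<bar>x\<bar>\<close>.\<close>
  have cos: "\<bar>cos (t * u) - cos (t * v)\<bar> \<le> \<bar>t\<bar> * \<bar>u - v\<bar>"
    and sin: "\<bar>sin (t * u) - sin (t * v)\<bar> \<le> \<bar>t\<bar> * \<bar>u - v\<bar>" for u v :: real
  proof -
    have "2 * \<bar>sin ((t * u - t * v) / 2)\<bar> \<le> \<bar>t * u - t * v\<bar>"
      using abs_sin_x_le_abs_x[of "(t * u - t * v) / 2"] by simp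
    then have *: "2 * \<bar>sin ((t * u - t * v) / 2)\<bar> \<le> \<bar>t\<bar> * \<bar>u - v\<bar>"
      by (simp add: abs_mult right_diff_distrib[symmetric])
    have "\<bar>cos (t * u) - cos (t * v)\<bar> = 2 * (\<bar>sin ((t * u - t * v) / 2)\<bar> * \<bar>sin ((t * u + t * v) / 2)\<bar>)"
      unfolding abs_minus_commute[of "cos (t * u)"] by (simp add: cos_diff_cos abs_mult add.commute)
    also have "\<dots> \<le> 2 * (\<bar>sin ((t * u - t * v) / 2)\<bar> * 1)"
      by (intro mult_left_mono) auto
    finally show "\<bar>cos (t * u) - cos (t * v)\<bar> \<le> \<bar>t\<bar> * \<bar>u - v\<bar>" using * by simp
    have "\<bar>sin (t * u) - sin (t * v)\<bar> = 2 * (\<bar>sin ((t * u - t * v) / 2)\<bar> * \<bar>cos ((t * u + t * v) / 2)\<bar>)"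
      by (simp add: sin_diff_sin abs_mult)
    also have "\<dots> \<le> 2 * (\<bar>sin ((t * u - t * v) / 2)\<bar> * 1)"
      by (intro mult_left_mono) auto
    finally show "\<bar>sin (t * u) - sin (t * v)\<bar> \<le> \<bar>t\<bar> * \<bar>u - v\<bar>" using * by simp
  qed
  obtain c s where "(\<lambda>n. \<phi> (\<lambda>u. cos (t * u)) (Suc n) i) \<longlonglongrightarrow> c"
      "(\<lambda>n. \<phi> (\<lambda>u. sin (t * u)) (Suc n) i) \<longlonglongrightarrow> s"
    using \<phi>_convergent[of "\<lambda>u. cos (t * u)", OF cos] \<phi>_convergent[of "\<lambda>u. sin (t * u)", OF sin]
    unfolding convergent_def by blast
  then show ?thesis
    unfolding char_R by (rule convergentI[OF tendsto_Complex])
qed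

text \<open>A continuous test function on the torus pulls back to a bounded continuous function on
  the line, so the weak limit of the lifts pushes forward.\<close>

lemma mu_weakly_convergent:
  "\<exists>\<nu>. sets \<nu> = sets borel \<and> finite_measure \<nu> \<and> weak_limit_torus (\<lambda>n. mu k F n $ i) \<nu>"
proof -
  obtain M where M: "real_distribution M" and conv: "weak_conv_m (\<lambda>n. R (Suc n) i) M"
    using weakly_convergent_if_char_convergent[OF tight_R convergent_char_R] by blast
  interpret M: real_distribution M by fact
  let ?\<nu> = "distr M borel to_torus"
  have "weak_limit_torus (\<lambda>n. mu k F n $ i) ?\<nu>"
    unfolding weak_limit_torus_def
  proof (intro allI impI)
    fix g :: "torus \<Rightarrow> real" assume g: "continuous_on UNIV g"
    have [measurable]: "g \<in> borel_measurable borel" using g by (rule borel_measurable_continuous_onI)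
    have cont: "continuous_on UNIV (\<lambda>u. g (to_torus u))"
      using continuous_on_compose2[OF g continuous_to_torus] by simp
    \<comment> \<open>Compactness bounds one period; periodicity extends the bound \<open>K\<close>
      to the whole line.\<close>
    have "bounded ((\<lambda>u. g (to_torus u)) ` {0..1})"
      by (intro compact_imp_bounded compact_continuous_image continuous_on_subset[OF cont]) auto
    then obtain K where K: "\<forall>u\<in>{0..1}. \<bar>g (to_torus u)\<bar> \<le> K"
      unfolding bounded_iff by auto
    have bound: "\<bar>g (to_torus u)\<bar> \<le> K" for u
    proof -
      have "to_torus u = to_torus (frac u)" using to_torus_Rep_torus[of "to_torus u"] by (simp add: Rep_torus_to_torus)
      then show ?thesis using K[rule_format, of "frac u"] by (simp add: less_imp_le[OF frac_lt_1])
    qed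
    have "(\<lambda>n. \<integral>u. g (to_torus u) \<partial>R (Suc n) i) \<longlonglongrightarrow> (\<integral>u. g (to_torus u) \<partial>M)"
      by (rule weak_conv_imp_integral_bdd_continuous_conv[OF real_distribution_R M conv, where B = K])
         (use cont bound in \<open>auto simp: continuous_on_eq_continuous_at\<close>)
    moreover have "(\<integral>z. g z \<partial>(mu k F n $ i)) = (\<integral>u. g (to_torus u) \<partial>R n i)" for n
      unfolding mu_eq_distr_R by (rule integral_distr) (simp_all add: R_def)
    moreover have "(\<integral>z. g z \<partial>?\<nu>) = (\<integral>u. g (to_torus u) \<partial>M)"
      by (rule integral_distr) simp_all
    ultimately have "(\<lambda>n. \<integral>z. g z \<partial>(mu k F (Suc n) $ i)) \<longlonglongrightarrow> (\<integral>z. g z \<partial>?\<nu>)"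
      by simp
    then show "(\<lambda>n. \<integral>z. g z \<partial>(mu k F n $ i)) \<longlonglongrightarrow> (\<integral>z. g z \<partial>?\<nu>)"
      by (rule LIMSEQ_imp_Suc)
  qed
  moreover have "finite_measure ?\<nu>" by (rule M.finite_measure_distr) simp
  ultimately show ?thesis by (intro exI[of _ ?\<nu>]) simp
qed

end

text \<open>Each \<open>F i\<close> lies in the kernel of \<open>f\<close> and so inherits its sign.
  A nonzero value at some \<open>m\<close> at least 1 exists because \<open>F i1 = f\<close> is not
  eventually zero.\<close>

lemma positive_recursionI:
  assumes "k \<ge> 2" and "kernel_basis k f F i1" and "digit_matrices k F B" and "primitive k f B"
  shows "positive_recursion k F B"
proof
  show "k \<ge> 2" by fact
  have basis: "F i1 = f" "range F \<subseteq> k_kernel k f"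
    using assms(2) by (auto simp: kernel_basis_def)
  have prim: "\<And>n. f n \<ge> 0" "\<not> (\<forall>\<^sub>F n in sequentially. f n = 0)"
      "\<And>a i j. a < k \<Longrightarrow> B a $ i $ j \<ge> 0" "\<And>i j. (\<Sum>a<k. B a) $ i $ j > 0"
    using assms(4) by (auto simp: primitive_def)
  show "F i m \<ge> 0" for i m
  proof -
    have "F i \<in> k_kernel k f" using basis by auto
    then show ?thesis using prim(1) by (auto simp: k_kernel_def)
  qed
  show "F i (k * m + a) = (\<Sum>j\<in>UNIV. B a $ i $ j * F j m)" if "a < k" for a i m
  proof -
    have "seq_vec F (k * m + a) $ i = (B a *v seq_vec F m) $ i"
      using assms(3) that by (simp add: digit_matrices_def)
    then show ?thesis by (simp add: seq_vec_def matrix_vector_mult_def)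
  qed
  show "B a $ i $ j \<ge> 0" if "a < k" for a i j using prim(3) that .
  show "(\<Sum>a<k. B a $ i $ j) > 0" for i j using prim(4)[of i j] by (simp add: sum_component)
  show "\<exists>m\<ge>1. \<exists>i. F i m \<noteq> 0"
    using prim(2) basis(1) unfolding eventually_sequentially by blast
qed

theorem theorem3p8:
  fixes k :: nat
    and f :: "nat \<Rightarrow> int"
    and F :: "'d::finite \<Rightarrow> nat \<Rightarrow> int"
    and i1 :: 'd
    and B :: "nat \<Rightarrow> int ^ 'd ^ 'd"
  assumes "k \<ge> 2"
    and "k_regular k f"
    and "kernel_basis k f F i1"
    and "digit_matrices k F B"
    and "primitive k f B"
  shows "\<exists>\<mu> :: torus measure ^ 'd. \<forall>i.
           sets (\<mu> $ i) = sets borel \<and> finite_measure (\<mu> $ i) \<and>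
           weak_limit_torus (\<lambda>n. mu k F n $ i) (\<mu> $ i) \<and>
           weak_limit_torus (\<lambda>N. mconv_mv (mconv_prod (A_dirac k F B) N) (mu k F 0) $ i) (\<mu> $ i)"
proof -
  interpret positive_recursion k F B
    using assms by (intro positive_recursionI)
  obtain \<nu> where "\<And>i. sets (\<nu> i) = sets borel \<and> finite_measure (\<nu> i)
      \<and> weak_limit_torus (\<lambda>n. mu k F n $ i) (\<nu> i)"
    using mu_weakly_convergent by metis
  then show ?thesis
    by (intro exI[of _ "\<chi> i. \<nu> i"]) (simp add: mconv_prod_A_dirac_mu)
qed

end
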